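(* There exist a positive number $\alpha<1$ and a non-elliptic semigroup $(\phi_t)_{t\ge0}$ of holomorphic self-maps of the unit disk $\mathbb{D}$, with total speed $v$, such that \[ \limsup_{t\to +\infty}\frac{v(t)}{t^\alpha}=+\infty\qquad\text{and}\qquad \liminf_{t\to +\infty}\frac{v(t)}{t^\alpha}=0. \]
   Context: $\mathbb{D}=\{z\in\mathbb{C}:|z|<1\}$. A family $(\phi_t)_{t\ge 0}$ of holomorphic maps $\phi_t:\mathbb{D}\to\mathbb{D}$ is a semigroup if (a) $\phi_0$ is the identity; (b) $\phi_{t+s}=\phi_t\circ\phi_s$ for all $t,s\ge 0$; (c) $\lim_{t\to s}\phi_t(z)=\phi_s(z)$ for every $s\ge 0$ and $z\in\mathbb{D}$. It is non-elliptic if for every $t>0$ the map $\phi_t$ has no fixed points in $\mathbb{D}$. The hyperbolic distance $\rho_{\mathbb{D}}$ is the distance induced by the metric $|dz|/(1-|z|^2)$, i.e. $\rho_{\mathbb{D}}(z,w)=\frac12\log\frac{1+|T(z,w)|}{1-|T(z,w)|}$ with $T(z,w)=\frac{z-w}{1-z\overline{w}}$. The total speed of the semigroup is $v(t)=\rho_{\mathbb{D}}(0,\phi_t(0))$, $t\ge 0$. *)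

theory Defs
  imports "HOL-Complex_Analysis.Complex_Analysis"
begin

abbreviation unit_disc :: "complex set" (\<open>\<D>\<close>)
  where "\<D> \<equiv> ball 0 1"

text \<open>
  A semigroup is a function \<open>\<phi> :: real \<Rightarrow> complex \<Rightarrow> complex\<close>; only the values \<open>\<phi> t z\<close> with
  \<open>t \<ge> 0\<close> and \<open>z\<close> in the unit disc matter, and every condition is relativised accordingly. In
  particular the limit in the continuity condition is taken over \<open>t \<ge> 0\<close>, hence one-sided at
  \<open>s = 0\<close>.
\<close>

definition holo_semigroup :: "(real \<Rightarrow> complex \<Rightarrow> complex) \<Rightarrow> bool" where
  "holo_semigroup \<phi> \<longleftrightarrow>
     (\<forall>t\<ge>0. \<phi> t holomorphic_on \<D> \<and> \<phi> t ` \<D> \<subseteq> \<D>) \<and>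
     (\<forall>z\<in>\<D>. \<phi> 0 z = z) \<and>
     (\<forall>t\<ge>0. \<forall>s\<ge>0. \<forall>z\<in>\<D>. \<phi> (t + s) z = \<phi> t (\<phi> s z)) \<and>
     (\<forall>s\<ge>0. \<forall>z\<in>\<D>. ((\<lambda>t. \<phi> t z) \<longlongrightarrow> \<phi> s z) (at s within {0..}))"

definition non_elliptic :: "(real \<Rightarrow> complex \<Rightarrow> complex) \<Rightarrow> bool" where
  "non_elliptic \<phi> \<longleftrightarrow> (\<forall>t>0. \<forall>z\<in>\<D>. \<phi> t z \<noteq> z)"

text \<open>
  The distance induced by the metric \<open>|dz| / (1 - |z|^2)\<close> (curvature \<open>-4\<close>), in closed form;
  meaningful for \<open>z\<close>, \<open>w\<close> in the unit disc.
\<close>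

definition hyp_dist :: "complex \<Rightarrow> complex \<Rightarrow> real" where
  "hyp_dist z w =
     (let T = (z - w) / (1 - z * cnj w)
      in 1/2 * ln ((1 + cmod T) / (1 - cmod T)))"

definition total_speed :: "(real \<Rightarrow> complex \<Rightarrow> complex) \<Rightarrow> real \<Rightarrow> real" where
  "total_speed \<phi> t = hyp_dist 0 (\<phi> t 0)"

end

theory Submission
  imports Defs
begin

text \<open>
  Transport the translations \<open>w \<mapsto> w + t\<close> by a Koenigs map \<open>k\<close> on the right half-plane with
  \<open>Re k' > 0\<close> and proper real part: such a \<open>k\<close> is injective and its image is invariant under
  translation to the right. If \<open>k\<close> is real on the positive axis and \<open>k x = k 1 + t\<close> with
  \<open>x \<ge> 1\<close>, the total speed at time \<open>t\<close> is \<open>(ln x) / 2\<close>, so \<open>t\<close> compares with \<open>v(t)\<^sup>2\<close> as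
  \<open>k x\<close> with \<open>(ln x)\<^sup>2\<close>. Take
  \<open>k z = (\<Sum>n. b\<^sub>n\<^sup>3 Ln (1 + z / exp (b\<^sub>n\<^sup>2)))\<close> with \<open>b\<^sub>n\<close> growing so fast that
  \<open>b\<^sub>n\<^sub>+\<^sub>1 = b\<^sub>n\<^sup>3\<close>. At \<open>x = exp (b\<^sub>n\<^sup>2)\<close> the \<open>n\<close>-th term has not yet
  started to grow and \<open>k x \<le> 4 b\<^sub>n\<^sup>3\<close> is far below \<open>(ln x)\<^sup>2 = b\<^sub>n\<^sup>4\<close>, while
  at \<open>x = exp (2 b\<^sub>n\<^sup>2)\<close> that term alone gives \<open>k x \<ge> b\<^sub>n\<^sup>5\<close>. Hence the
  exponent \<open>\<alpha> = 1/2\<close> works.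
\<close>

section \<open>Univalence of the Koenigs map and translation invariance of its image\<close>

abbreviation right_half_plane :: "complex set" (\<open>\<H>\<close>)
  where "\<H> \<equiv> {z. 0 < Re z}"

lemma open_right_half_plane: "open \<H>"
  by (rule open_halfspace_Re_gt)

lemma convex_right_half_plane: "convex \<H>"
  by (rule convex_halfspace_Re_gt)

text \<open>The Noshiro-Warschawski criterion: convexity allows a mean value argument along the
  segment between two points with the same image.\<close>

lemma inj_on_if_Re_deriv_pos:
  assumes "convex S" and "open S" and holo: "k holomorphic_on S"
    and pos: "\<And>z. z \<in> S \<Longrightarrow> 0 < Re (deriv k z)"
  shows "inj_on k S"
proof (rule inj_onI, rule ccontr)
  fix a b assume ab: "a \<in> S" "b \<in> S" "k a = k b" "a \<noteq> b"
  have seg: "closed_segment a b \<subseteq> S"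
    using ab \<open>convex S\<close> by (simp add: closed_segment_subset)
  \<comment> \<open>The complex mean value theorem only controls real parts and carries a factor
    \<open>b - a\<close>. Dividing \<open>k\<close> by \<open>b - a\<close> beforehand cancels it,
    leaving exactly \<open>Re (deriv k u)\<close>.\<close>
  have "\<And>u. u \<in> closed_segment a b \<Longrightarrow>
      ((\<lambda>z. k z / (b - a)) has_field_derivative deriv k u / (b - a)) (at u)"
    using seg by (intro DERIV_cdivide holomorphic_derivI[OF holo \<open>open S\<close>]) auto
  from complex_mvt_line[of a b, OF this] obtain u where u: "u \<in> closed_segment a b"
      "Re (k b / (b - a)) - Re (k a / (b - a)) = Re (deriv k u / (b - a) * (b - a))"
    by blast
  then have "Re (deriv k u) = 0" using ab by simp
  with pos[of u] seg u(1) show False by auto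
qed

text \<open>The inverse of \<open>k\<close> has derivative in \<open>\<H>\<close>, so its real part increases along horizontal
  segments; together with the properness this keeps the preimage of a segment in a compact subset
  of \<open>\<H>\<close>, and the segment cannot leave the image.\<close>

lemma image_translation_invariant:
  assumes holo: "k holomorphic_on \<H>"
    and pos: "\<And>z. z \<in> \<H> \<Longrightarrow> 0 < Re (deriv k z)"
    and proper: "\<And>C. bounded {z \<in> \<H>. Re (k z) \<le> C}"
    and z0: "z0 \<in> \<H>" and t: "0 \<le> t"
  shows "k z0 + of_real t \<in> k ` \<H>"
proof (rule ccontr)
  assume notin: "k z0 + of_real t \<notin> k ` \<H>"
  have inj: "inj_on k \<H>"
    by (rule inj_on_if_Re_deriv_pos[OF convex_right_half_plane open_right_half_plane holo pos])
  obtain g where g: "g holomorphic_on k ` \<H>"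
      "\<And>z. z \<in> \<H> \<Longrightarrow> deriv k z * deriv g (k z) = 1" "\<And>z. z \<in> \<H> \<Longrightarrow> g (k z) = z"
    using holomorphic_has_inverse[OF holo open_right_half_plane inj] by metis
  have opn: "open (k ` \<H>)"
    by (rule open_mapping_thm3[OF holo open_right_half_plane inj])
  \<comment> \<open>The times at which the translated point is outside the image. Openness of the
    image makes \<open>B\<close> closed, so the first exit time \<open>Inf B\<close> is itself in
    \<open>B\<close>; the rest shows that the point at that time has a preimage after all.\<close>
  define B where "B = {s. 0 \<le> s \<and> k z0 + of_real s \<notin> k ` \<H>}"
  have "B = {0..} \<inter> (\<lambda>s. k z0 + of_real s) -` (- (k ` \<H>))"
    by (auto simp: B_def)
  moreover have "closed ((\<lambda>s::real. k z0 + of_real s) -` (- (k ` \<H>)))"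
    using opn by (intro closed_vimage) (auto intro!: continuous_intros simp: closed_Compl)
  ultimately have "closed B" by (auto intro: closed_Int)
  moreover have "B \<noteq> {}" "bdd_below B"
    using notin t by (auto simp: B_def bdd_below_def)
  ultimately have "Inf B \<in> B" by (intro closed_contains_Inf)
  define s where "s = Inf B"
  have s: "0 \<le> s" "k z0 + of_real s \<notin> k ` \<H>"
    using \<open>Inf B \<in> B\<close> by (auto simp: s_def B_def)
  with z0 have "0 < s" by (cases "s = 0") auto
  have below: "k z0 + of_real r \<in> k ` \<H>" if "0 \<le> r" "r < s" for r
    using cInf_lower[OF _ \<open>bdd_below B\<close>, of r] that by (force simp: s_def B_def)
  have Re_ge: "Re z0 \<le> Re (g (k z0 + of_real r))" if r: "0 \<le> r" "r < s" for r
  proof -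
    have "Re (g (k z0 + of_real 0)) \<le> Re (g (k z0 + of_real r))"
    proof (rule DERIV_nonneg_imp_nondecreasing[OF r(1)])
      fix x assume "0 \<le> x" "x \<le> r"
      then have mem: "k z0 + of_real x \<in> k ` \<H>" using below r by auto
      then obtain y where y: "y \<in> \<H>" "k z0 + of_real x = k y" by blast
      have "(g has_field_derivative deriv g (k z0 + of_real x)) (at (k z0 + of_real x))"
        by (rule holomorphic_derivI[OF g(1) opn mem])
      moreover have "((\<lambda>u. k z0 + u) has_field_derivative 1) (at (of_real x))"
        by (auto intro!: derivative_eq_intros)
      ultimately have "((\<lambda>u. g (k z0 + u)) has_field_derivative deriv g (k z0 + of_real x))
          (at (of_real x))"
        by (metis DERIV_chain2 mult.right_neutral)
      then have "((\<lambda>u::real. g (k z0 + of_real u)) has_vector_derivative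
          deriv g (k z0 + of_real x)) (at x)"
        using has_vector_derivative_real_field by blast
      then have "((\<lambda>u::real. Re (g (k z0 + of_real u))) has_real_derivative
          Re (deriv g (k z0 + of_real x))) (at x)"
        using has_field_derivative_Re by blast
      moreover have "deriv g (k y) = inverse (deriv k y)"
        using g(2)[OF y(1)] by (metis inverse_unique)
      then have "0 \<le> Re (deriv g (k z0 + of_real x))"
        using pos[OF y(1)] y(2) by simp
      ultimately show "\<exists>d. ((\<lambda>u::real. Re (g (k z0 + of_real u))) has_real_derivative d) (at x)
          \<and> 0 \<le> d" by blast
    qed
    then show ?thesis using g(3)[OF z0] by simp
  qed
  define r where "r n = s * (1 - 1 / (real n + 1))" for n
  have r: "0 \<le> r n" "r n < s" for n
    using \<open>0 < s\<close> by (auto simp: r_def field_simps)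
  have rlim: "r \<longlonglongrightarrow> s"
    unfolding r_def by real_asymp
  define z where "z n = g (k z0 + of_real (r n))" for n
  have kz: "k (z n) = k z0 + of_real (r n)" and zH: "z n \<in> \<H>" for n
    using below[OF r(1,2), of n] g(3) by (auto simp: z_def)
  \<comment> \<open>Properness applies because \<open>Re (k (z n))\<close> stays below
    \<open>Re (k z0) + s\<close>, so the preimages accumulate at some \<open>l\<close>.\<close>
  have "range z \<subseteq> {z \<in> \<H>. Re (k z) \<le> Re (k z0) + s}"
    using kz zH r(2) by (force intro: less_imp_le)
  then have "bounded (range z)" using proper bounded_subset by blast
  then obtain l \<sigma> where \<sigma>: "strict_mono (\<sigma> :: nat \<Rightarrow> nat)" "(z \<circ> \<sigma>) \<longlonglongrightarrow> l"
    using bounded_imp_convergent_subsequence by blast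
  \<comment> \<open>Monotonicity of the real part prevents \<open>l\<close> from lying on the
    imaginary axis.\<close>
  have "Re z0 \<le> Re l"
    using tendsto_Re[OF \<sigma>(2)] by (rule tendsto_lowerbound) (use Re_ge r in \<open>auto simp: z_def\<close>)
  then have lH: "l \<in> \<H>" using z0 by auto
  have "isCont k l"
    using holo lH open_right_half_plane holomorphic_on_imp_continuous_on continuous_on_eq_continuous_at
    by blast
  then have "(\<lambda>n. k ((z \<circ> \<sigma>) n)) \<longlonglongrightarrow> k l"
    using \<sigma>(2) isCont_tendsto_compose by blast
  moreover have "(\<lambda>n. k ((z \<circ> \<sigma>) n)) \<longlonglongrightarrow> k z0 + of_real s"
    using LIMSEQ_subseq_LIMSEQ[OF rlim \<sigma>(1)]
    by (auto simp: kz o_def intro!: tendsto_intros)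
  ultimately have "k l = k z0 + of_real s" using LIMSEQ_unique by blast
  with s(2) lH show False by (metis image_eqI)
qed

section \<open>The Cayley transform and hyperbolic distance\<close>

definition cayley :: "complex \<Rightarrow> complex" where "cayley z = (1 + z) / (1 - z)"

definition cayley_inv :: "complex \<Rightarrow> complex" where "cayley_inv w = (w - 1) / (w + 1)"

lemma cayley_in_right_half_plane: "z \<in> \<D> \<Longrightarrow> cayley z \<in> \<H>"
proof -
  assume "z \<in> \<D>"
  then have n: "norm z < 1" by simp
  then have "z \<noteq> 1" by auto
  then have "0 < (cmod (1 - z))\<^sup>2" by simp
  moreover have "(cmod z)\<^sup>2 < 1" using n by (simp add: power_less_one_iff abs_square_less_1)
  moreover have "Re (cayley z) = (1 - (cmod z)\<^sup>2) / (cmod (1 - z))\<^sup>2"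
    unfolding cayley_def Re_divide cmod_power2 by (simp add: algebra_simps power2_eq_square)
  ultimately show ?thesis by simp
qed

lemma cayley_inv_in_disc: "w \<in> \<H> \<Longrightarrow> cayley_inv w \<in> \<D>"
proof -
  assume w: "w \<in> \<H>"
  then have "(cmod (w - 1))\<^sup>2 < (cmod (w + 1))\<^sup>2"
    unfolding cmod_power2 by (simp add: power2_eq_square algebra_simps)
  then have "cmod (w - 1) < cmod (w + 1)" by (simp add: power_less_imp_less_base)
  then show ?thesis unfolding cayley_inv_def by (simp add: norm_divide divide_less_eq)
qed

lemma cayley_inv_cayley: "z \<in> \<D> \<Longrightarrow> cayley_inv (cayley z) = z"
proof -
  assume "z \<in> \<D>"
  then have "1 - z \<noteq> 0" by auto
  then show ?thesis unfolding cayley_def cayley_inv_def by (simp add: field_simps)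
qed

lemma cayley_cayley_inv: "w \<in> \<H> \<Longrightarrow> cayley (cayley_inv w) = w"
proof -
  assume "w \<in> \<H>"
  then have "w + 1 \<noteq> 0" by (auto simp: complex_eq_iff)
  then have "1 + cayley_inv w = 2 * w / (w + 1)" "1 - cayley_inv w = 2 / (w + 1)"
    unfolding cayley_inv_def by (auto simp: field_simps)
  with \<open>w + 1 \<noteq> 0\<close> show ?thesis unfolding cayley_def by simp
qed

text \<open>The quotient inside the logarithm of \<open>hyp_dist\<close> is the Cayley transform of
  the modulus, so it returns \<open>x\<close>. For \<open>x < 1\<close> the modulus changes sign and
  the result would be \<open>- ln x / 2\<close>.\<close>

lemma hyp_dist_0_cayley_inv:
  assumes "1 \<le> x"
  shows "hyp_dist 0 (cayley_inv (of_real x)) = ln x / 2"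
proof -
  have "cayley_inv (of_real x) = of_real ((x - 1) / (x + 1))"
    by (simp add: cayley_inv_def)
  then have n: "cmod (cayley_inv (of_real x)) = (x - 1) / (x + 1)"
    using assms by (simp only: norm_of_real) simp
  have "(1 + (x - 1) / (x + 1)) / (1 - (x - 1) / (x + 1)) = x"
    using assms by (simp add: field_simps)
  then show ?thesis by (simp add: hyp_dist_def n)
qed

section \<open>From a Koenigs map to a semigroup\<close>

text \<open>Conjugating translation by \<open>k\<close> composed with \<open>cayley\<close> turns
  the semigroup law into addition of times, and a fixed point would give
  \<open>of_real t = 0\<close>. Since \<open>cayley 0 = 1\<close>, the orbit of 0 is found by
  solving \<open>k x = k 1 + t\<close>.\<close>

lemma semigroup_of_koenigs_map:
  assumes holo: "k holomorphic_on \<H>"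
    and pos: "\<And>z. z \<in> \<H> \<Longrightarrow> 0 < Re (deriv k z)"
    and proper: "\<And>C. bounded {z \<in> \<H>. Re (k z) \<le> C}"
  obtains \<phi> where "holo_semigroup \<phi>" and "non_elliptic \<phi>"
    and "\<And>t x. 0 \<le> t \<Longrightarrow> 1 \<le> x \<Longrightarrow> k (of_real x) = k 1 + of_real t \<Longrightarrow> total_speed \<phi> t = ln x / 2"
proof -
  have inj: "inj_on k \<H>"
    by (rule inj_on_if_Re_deriv_pos[OF convex_right_half_plane open_right_half_plane holo pos])
  have opn: "open (k ` \<H>)"
    by (rule open_mapping_thm3[OF holo open_right_half_plane inj])
  obtain g where g: "g holomorphic_on k ` \<H>" "\<And>z. z \<in> \<H> \<Longrightarrow> g (k z) = z"
    using holomorphic_has_inverse[OF holo open_right_half_plane inj] by metis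
  have trans: "k z + of_real t \<in> k ` \<H>" if "z \<in> \<H>" "0 \<le> t" for z t
    using image_translation_invariant[OF holo pos proper that] .
  define \<phi> where "\<phi> t z = cayley_inv (g (k (cayley z) + of_real t))" for t z
  have gH: "g w \<in> \<H>" and kg: "k (g w) = w" if "w \<in> k ` \<H>" for w
    using that g(2) by auto
  \<comment> \<open>The linearising equation; both the semigroup law and the absence of fixed points
    are read off from it.\<close>
  have k_cayley: "k (cayley (\<phi> t z)) = k (cayley z) + of_real t"
    and mem: "\<phi> t z \<in> \<D>" if "z \<in> \<D>" "0 \<le> t" for t z
  proof -
    have w: "k (cayley z) + of_real t \<in> k ` \<H>"
      using trans cayley_in_right_half_plane that by blast
    show "k (cayley (\<phi> t z)) = k (cayley z) + of_real t"
      by (simp only: \<phi>_def cayley_cayley_inv[OF gH[OF w]] kg[OF w])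
    show "\<phi> t z \<in> \<D>"
      unfolding \<phi>_def by (rule cayley_inv_in_disc[OF gH[OF w]])
  qed
  have cayley_holo: "cayley holomorphic_on \<D>"
    unfolding cayley_def by (intro holomorphic_intros) auto
  have cayley_inv_holo: "cayley_inv holomorphic_on \<H>"
    unfolding cayley_inv_def by (intro holomorphic_intros) (auto simp: complex_eq_iff)
  have "holo_semigroup \<phi>"
    unfolding holo_semigroup_def
  proof (intro conjI allI impI ballI)
    fix t :: real assume t: "0 \<le> t"
    have "(\<lambda>z. k (cayley z) + of_real t) holomorphic_on \<D>"
      using holomorphic_on_compose_gen[OF cayley_holo holo image_subsetI[OF cayley_in_right_half_plane]]
      by (auto simp: o_def intro!: holomorphic_intros)
    moreover have "(\<lambda>z. k (cayley z) + of_real t) ` \<D> \<subseteq> k ` \<H>"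
      using trans[OF cayley_in_right_half_plane t] by blast
    ultimately have "(g \<circ> (\<lambda>z. k (cayley z) + of_real t)) holomorphic_on \<D>"
      using g(1) holomorphic_on_compose_gen by blast
    moreover have "(g \<circ> (\<lambda>z. k (cayley z) + of_real t)) ` \<D> \<subseteq> \<H>"
      using gH trans[OF cayley_in_right_half_plane t] by (auto simp del: mem_ball_0)
    ultimately have "(cayley_inv \<circ> (g \<circ> (\<lambda>z. k (cayley z) + of_real t))) holomorphic_on \<D>"
      using cayley_inv_holo holomorphic_on_compose_gen by blast
    then show "\<phi> t holomorphic_on \<D>" by (simp add: \<phi>_def[abs_def] o_def)
    show "\<phi> t ` \<D> \<subseteq> \<D>" using mem t by blast
  next
    fix z assume "z \<in> \<D>"
    then show "\<phi> 0 z = z"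
      using g(2)[OF cayley_in_right_half_plane] by (simp add: \<phi>_def cayley_inv_cayley)
  next
    fix t s :: real and z assume "0 \<le> t" "0 \<le> s" "z \<in> \<D>"
    then have "k (cayley (\<phi> s z)) + of_real t = k (cayley z) + of_real (t + s)"
      by (simp add: k_cayley)
    then show "\<phi> (t + s) z = \<phi> t (\<phi> s z)"
      unfolding \<phi>_def[of "t + s"] \<phi>_def[of t] by (simp only:)
  next
    fix s :: real and z assume s: "0 \<le> s" and z: "z \<in> \<D>"
    have w: "k (cayley z) + of_real s \<in> k ` \<H>"
      using trans cayley_in_right_half_plane s z by blast
    have "isCont g (k (cayley z) + of_real s)"
      using g(1) opn w holomorphic_on_imp_continuous_on continuous_on_eq_continuous_at by blast
    moreover have "isCont cayley_inv (g (k (cayley z) + of_real s))"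
      using cayley_inv_holo gH[OF w] open_right_half_plane holomorphic_on_imp_continuous_on
        continuous_on_eq_continuous_at by blast
    moreover have "((\<lambda>t. k (cayley z) + of_real t) \<longlongrightarrow> k (cayley z) + of_real s) (at s)"
      by (intro tendsto_intros)
    ultimately have "((\<lambda>t. \<phi> t z) \<longlongrightarrow> \<phi> s z) (at s)"
      unfolding \<phi>_def using isCont_tendsto_compose by blast
    then show "((\<lambda>t. \<phi> t z) \<longlongrightarrow> \<phi> s z) (at s within {0..})"
      by (rule tendsto_within_subset) simp
  qed
  moreover have "non_elliptic \<phi>"
    unfolding non_elliptic_def
  proof (intro allI impI ballI notI)
    fix t :: real and z assume "0 < t" "z \<in> \<D>" "\<phi> t z = z"
    with k_cayley[of z t] show False by simp
  qed
  moreover have "total_speed \<phi> t = ln x / 2"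
    if "0 \<le> t" "1 \<le> x" and kx: "k (of_real x) = k 1 + of_real t" for t x
  proof -
    have "\<phi> t 0 = cayley_inv (of_real x)"
      using g(2)[of "of_real x"] \<open>1 \<le> x\<close> by (simp add: \<phi>_def cayley_def flip: kx)
    then show ?thesis
      using hyp_dist_0_cayley_inv[OF \<open>1 \<le> x\<close>] by (simp add: total_speed_def)
  qed
  ultimately show thesis by (rule that)
qed

section \<open>The rapidly growing sequence\<close>

definition b :: "nat \<Rightarrow> real" where "b n = 2 ^ (3 ^ n)"

lemma b_Suc: "b (Suc n) = b n ^ 3"
  by (simp only: b_def power_Suc2 power_mult)

lemma b_ge_power: "2 * 2 ^ n \<le> b n"
proof -
  have "Suc n \<le> 3 ^ n" by (induction n) auto
  then have "(2::real) ^ Suc n \<le> 2 ^ (3 ^ n)" by (intro power_increasing) auto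
  then show ?thesis by (simp add: b_def)
qed

lemma b_ge_2: "2 \<le> b n"
  using b_ge_power[of n] one_le_power[of "2::real" n] by linarith

lemma b_pos [simp]: "0 < b n"
  using b_ge_2[of n] by linarith

lemma b_mono: "m \<le> n \<Longrightarrow> b m \<le> b n"
  unfolding b_def by (intro power_increasing) auto

lemma filterlim_b: "filterlim b at_top sequentially"
proof (rule filterlim_at_top_mono)
  show "filterlim (\<lambda>n. 2 * 2 ^ n :: real) at_top sequentially" by real_asymp
qed (use b_ge_power in auto)

text \<open>Cubing shifts the index, so the sum is \<open>b 1\<close> up to \<open>b n\<close>, and
  its last term dominates because \<open>2 * b n \<le> b n ^ 3\<close>.\<close>

lemma sum_b_cubed_le: "(\<Sum>k<n. b k ^ 3) \<le> 2 * b n"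
proof (induction n)
  case 0 then show ?case using b_ge_2[of 0] by simp
next
  case (Suc n)
  have "2 \<le> (b n)\<^sup>2"
    using power_mono[OF b_ge_2, of 2 n] by simp
  then have "2 * b n \<le> b n ^ 3"
    using mult_right_mono[of 2 "(b n)\<^sup>2" "b n"] by (simp add: power_numeral_reduce less_imp_le mult_ac)
  with Suc show ?case by (simp add: b_Suc)
qed

text \<open>From \<open>y ^ 2 / 2 \<le> exp y\<close> at \<open>y = b n ^ 2 / 2\<close> the product
  is at most \<open>8 / b n\<close>. Only half of the exponent is spent here: the other half later
  absorbs the factor \<open>exp (b m ^ 2)\<close> of an earlier index \<open>m\<close>.\<close>

lemma b_cubed_exp_le: "b n ^ 3 * exp (- (b n)\<^sup>2 / 2) \<le> 4 * (1 / 2) ^ n"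
proof -
  have "((b n)\<^sup>2 / 2)\<^sup>2 / 2 \<le> exp ((b n)\<^sup>2 / 2)"
    using exp_lower_Taylor_quadratic[of "(b n)\<^sup>2 / 2"] by (smt (verit) zero_le_power2 divide_nonneg_nonneg)
  then have "b n ^ 4 / 8 \<le> exp ((b n)\<^sup>2 / 2)"
    by (simp add: power_divide flip: power_mult)
  then have "1 / exp ((b n)\<^sup>2 / 2) \<le> 1 / (b n ^ 4 / 8)"
    by (intro divide_left_mono mult_pos_pos) (auto simp: less_imp_neq[OF b_pos, symmetric])
  then have "exp (- (b n)\<^sup>2 / 2) \<le> 8 / b n ^ 4"
    by (simp add: exp_minus inverse_eq_divide)
  then have "b n ^ 3 * exp (- (b n)\<^sup>2 / 2) \<le> b n ^ 3 * (8 / b n ^ 4)"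
    by (intro mult_left_mono) (auto simp: less_imp_le)
  also have "\<dots> = 8 / b n" by (simp add: field_simps power_numeral_reduce)
  also have "\<dots> \<le> 8 / (2 * 2 ^ n)"
    by (rule divide_left_mono[OF b_ge_power]) auto
  also have "\<dots> = 4 * (1 / 2) ^ n" by (simp add: power_divide)
  finally show ?thesis .
qed

lemma summable_b_cubed_exp: "summable (\<lambda>n. b n ^ 3 * exp (- (b n)\<^sup>2))"
proof (rule summable_comparison_test')
  show "summable (\<lambda>n. 4 * (1 / 2) ^ n :: real)"
    by (intro summable_mult summable_geometric) auto
  fix n
  have "b n ^ 3 * exp (- (b n)\<^sup>2) \<le> b n ^ 3 * exp (- (b n)\<^sup>2 / 2)"
    by (intro mult_left_mono) (auto simp: less_imp_le)
  from order_trans[OF this b_cubed_exp_le]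
  show "norm (b n ^ 3 * exp (- (b n)\<^sup>2)) \<le> 4 * (1 / 2) ^ n"
    by (simp add: abs_mult less_imp_le)
qed

section \<open>Bounds for the logarithmic series, and its growth on the positive axis\<close>

text \<open>On the closed right half-plane, which is convex, the derivative
  \<open>1 / (1 + w)\<close> has modulus at most 1. The linear bound makes the complex series
  converge locally uniformly.\<close>

lemma norm_Ln_one_plus_le:
  assumes "0 \<le> Re z"
  shows "cmod (Ln (1 + z)) \<le> cmod z"
proof -
  have nonneg: "1 + w \<notin> \<real>\<^sub>\<le>\<^sub>0" if "0 \<le> Re w" for w :: complex
    using that by (auto simp: complex_nonpos_Reals_iff)
  have "cmod (Ln (1 + z) - Ln (1 + 0)) \<le> 1 * cmod (z - 0)"
  proof (rule field_differentiable_bound[of "{w. 0 \<le> Re w}"])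
    show "convex {w. 0 \<le> Re w}" by (rule convex_halfspace_Re_ge)
    fix w :: complex assume w: "w \<in> {w. 0 \<le> Re w}"
    then have "1 + w \<notin> \<real>\<^sub>\<le>\<^sub>0" using nonneg by simp
    then show "((\<lambda>w. Ln (1 + w)) has_field_derivative 1 / (1 + w)) (at w within {w. 0 \<le> Re w})"
      by (auto intro!: derivative_eq_intros simp: divide_inverse)
    have "1 \<le> cmod (1 + w)" using complex_Re_le_cmod[of "1 + w"] w by simp
    then show "cmod (1 / (1 + w)) \<le> 1" by (auto simp: norm_divide divide_le_eq)
  qed (use assms in auto)
  then show ?thesis by simp
qed

text \<open>\<open>K\<close> is the restriction of the Koenigs map to the positive axis.\<close>

definition K_term :: "nat \<Rightarrow> real \<Rightarrow> real" where
  "K_term n x = b n ^ 3 * ln (1 + x / exp ((b n)\<^sup>2))"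

definition K :: "real \<Rightarrow> real" where "K x = (\<Sum>n. K_term n x)"

lemma K_term_nonneg: "0 \<le> x \<Longrightarrow> 0 \<le> K_term n x"
  unfolding K_term_def by (intro mult_nonneg_nonneg ln_ge_zero) (auto simp: less_imp_le)

lemma K_term_le:
  assumes "0 \<le> x"
  shows "K_term n x \<le> b n ^ 3 * exp (- (b n)\<^sup>2) * x"
proof -
  have "ln (1 + x / exp ((b n)\<^sup>2)) \<le> x / exp ((b n)\<^sup>2)"
    using assms by (intro ln_add_one_self_le_self) auto
  then have "K_term n x \<le> b n ^ 3 * (x / exp ((b n)\<^sup>2))"
    unfolding K_term_def by (intro mult_left_mono) (auto simp: less_imp_le)
  then show ?thesis by (simp add: exp_minus divide_inverse mult_ac)
qed

lemma summable_K_term: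
  assumes "0 \<le> x"
  shows "summable (\<lambda>n. K_term n x)"
proof (rule summable_comparison_test')
  show "summable (\<lambda>n. b n ^ 3 * exp (- (b n)\<^sup>2) * x)"
    by (intro summable_mult2 summable_b_cubed_exp)
qed (use K_term_le K_term_nonneg assms in auto)

lemma K_mono:
  assumes "0 \<le> x" "x \<le> y"
  shows "K x \<le> K y"
  unfolding K_def
proof (rule suminf_le)
  show "K_term n x \<le> K_term n y" for n
    unfolding K_term_def using assms
    by (intro mult_left_mono ln_mono add_left_mono divide_right_mono)
       (auto simp: less_imp_le add_pos_nonneg)
qed (use assms summable_K_term in auto)

lemma K_nonneg: "0 \<le> x \<Longrightarrow> 0 \<le> K x"
  unfolding K_def by (intro suminf_nonneg summable_K_term K_term_nonneg)

text \<open>A single term is kept and the 1 inside its logarithm dropped. Index 0 shows that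
  \<open>K\<close> is unbounded; at \<open>x = exp (2 * b n ^ 2)\<close> the bound is
  \<open>b n ^ 5\<close>.\<close>

lemma K_ge:
  assumes "0 < x"
  shows "b n ^ 3 * (ln x - (b n)\<^sup>2) \<le> K x"
proof -
  have "ln x - (b n)\<^sup>2 = ln (x / exp ((b n)\<^sup>2))" using assms by (simp add: ln_div)
  also have "\<dots> \<le> ln (1 + x / exp ((b n)\<^sup>2))"
    using assms by (intro ln_mono) auto
  finally have "b n ^ 3 * (ln x - (b n)\<^sup>2) \<le> K_term n x"
    unfolding K_term_def by (intro mult_left_mono) (auto simp: less_imp_le)
  also have "\<dots> \<le> K x"
    unfolding K_def using sum_le_suminf[OF summable_K_term, of x "{n}"] K_term_nonneg assms by simp
  finally show ?thesis .
qed

lemma filterlim_K: "filterlim K at_top at_top"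
proof (rule filterlim_at_top_mono)
  show "filterlim (\<lambda>x. b 0 ^ 3 * (ln x - (b 0)\<^sup>2)) at_top at_top"
    unfolding b_def by real_asymp
  show "\<forall>\<^sub>F x in at_top. b 0 ^ 3 * (ln x - (b 0)\<^sup>2) \<le> K x"
    using eventually_gt_at_top[of 0] by eventually_elim (rule K_ge)
qed

text \<open>The terms before \<open>n\<close> contribute at most \<open>2 * b n ^ 3\<close>, since
  each logarithm is at most \<open>b n ^ 2\<close>. The term \<open>n\<close> is
  \<open>b n ^ 3 * ln 2\<close>, and the later terms sum to at most 8, which is at most
  \<open>b n ^ 3\<close>.\<close>

lemma K_exp_le: "K (exp ((b n)\<^sup>2)) \<le> 4 * b n ^ 3"
proof -
  let ?x = "exp ((b n)\<^sup>2)"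
  \<comment> \<open>The bound for the indices up to \<open>n\<close>, extended by 0. Adding the
    geometric majorant of the tail at every index costs only 8 and avoids splitting the
    series.\<close>
  define c where
    "c k = (if k \<in> {..n} then if k = n then b n ^ 3 else b k ^ 3 * (b n)\<^sup>2 else 0)" for k
  have c_sums: "c sums (\<Sum>k\<le>n. if k = n then b n ^ 3 else b k ^ 3 * (b n)\<^sup>2)"
    unfolding c_def by (rule sums_If_finite_set) simp
  have "(\<Sum>k\<le>n. if k = n then b n ^ 3 else b k ^ 3 * (b n)\<^sup>2)
      = (\<Sum>k<n. b k ^ 3) * (b n)\<^sup>2 + b n ^ 3"
    by (simp add: sum_distrib_right flip: lessThan_Suc_atMost)
  also have "\<dots> \<le> 2 * b n * (b n)\<^sup>2 + b n ^ 3"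
    by (intro add_right_mono mult_right_mono sum_b_cubed_le) auto
  also have "\<dots> = 3 * b n ^ 3" by (simp add: power_numeral_reduce)
  finally have c_le: "(\<Sum>k\<le>n. if k = n then b n ^ 3 else b k ^ 3 * (b n)\<^sup>2) \<le> 3 * b n ^ 3" .
  have sq_ge: "4 \<le> (b k)\<^sup>2" for k
    using power_mono[OF b_ge_2, of 2 k] by simp
  have geo: "(\<lambda>k. 4 * (1 / 2) ^ k :: real) sums 8"
    using sums_mult[OF geometric_sums[of "1/2::real"], of 4] by simp
  have term_le: "K_term k ?x \<le> c k + 4 * (1 / 2) ^ k" for k
  proof (cases k n rule: linorder_cases)
    case less
    \<comment> \<open>With \<open>?x \<ge> 2\<close> this gives
      \<open>1 + ?x / exp (b k ^ 2) \<le> 1 + ?x / 2 \<le> ?x\<close>.\<close>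
    have "exp (- (b k)\<^sup>2) \<le> 1 / 2"
    proof -
      have "2 \<le> exp ((b k)\<^sup>2)" using exp_ge_add_one_self[of "(b k)\<^sup>2"] sq_ge[of k] by linarith
      then show ?thesis by (simp add: exp_minus field_simps)
    qed
    then have "?x * exp (- (b k)\<^sup>2) \<le> ?x * (1 / 2)" by (intro mult_left_mono) auto
    moreover have "2 \<le> ?x" using exp_ge_add_one_self[of "(b n)\<^sup>2"] sq_ge[of n] by linarith
    ultimately have "1 + ?x * exp (- (b k)\<^sup>2) \<le> ?x" by linarith
    then have "1 + ?x / exp ((b k)\<^sup>2) \<le> ?x" by (simp only: exp_minus divide_inverse)
    then have "ln (1 + ?x / exp ((b k)\<^sup>2)) \<le> ln ?x"
      by (intro ln_mono add_pos_pos divide_pos_pos) auto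
    then have "ln (1 + ?x / exp ((b k)\<^sup>2)) \<le> (b n)\<^sup>2" by (simp only: ln_exp)
    then have "K_term k ?x \<le> b k ^ 3 * (b n)\<^sup>2"
      unfolding K_term_def by (intro mult_left_mono) (auto simp: less_imp_le)
    then show ?thesis using less by (simp add: c_def add_increasing2)
  next
    case equal
    have "K_term n ?x \<le> b n ^ 3 * 1"
      unfolding K_term_def using ln_2_less_1 by (intro mult_left_mono) (auto simp: less_imp_le)
    then show ?thesis using equal by (simp add: c_def add_increasing2)
  next
    case greater
    \<comment> \<open>The gap comes from cubing: \<open>b k\<close> is at least
      \<open>b n ^ 3\<close>. It makes \<open>b n ^ 2 - b k ^ 2\<close> at most
      \<open>- (b k ^ 2) / 2\<close>, the exponent in \<open>b_cubed_exp_le\<close>.\<close>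
    have "2 * (b n)\<^sup>2 \<le> (b k)\<^sup>2"
    proof -
      have "2 * (b n)\<^sup>2 \<le> ((b n)\<^sup>2) * ((b n)\<^sup>2)"
        using sq_ge[of n] by (intro mult_right_mono) auto
      also have "\<dots> \<le> (b n ^ 3)\<^sup>2"
        using power_increasing[of 4 6 "b n"] b_ge_2[of n] by (simp flip: power_mult power_add)
      also have "\<dots> \<le> (b k)\<^sup>2"
        using b_mono[of "Suc n" k] greater by (intro power_mono) (auto simp: b_Suc less_imp_le)
      finally show ?thesis .
    qed
    then have "exp ((b n)\<^sup>2 - (b k)\<^sup>2) \<le> exp (- (b k)\<^sup>2 / 2)" by simp
    then have "b k ^ 3 * exp ((b n)\<^sup>2 - (b k)\<^sup>2) \<le> b k ^ 3 * exp (- (b k)\<^sup>2 / 2)"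
      by (intro mult_left_mono) (auto simp: less_imp_le)
    moreover have "b k ^ 3 * exp (- (b k)\<^sup>2) * ?x = b k ^ 3 * exp ((b n)\<^sup>2 - (b k)\<^sup>2)"
      by (simp add: exp_diff exp_minus divide_inverse)
    moreover have "c k = 0" using greater by (simp add: c_def)
    ultimately show ?thesis
      using K_term_le[OF exp_ge_zero, of k "(b n)\<^sup>2"] b_cubed_exp_le[of k] by linarith
  qed
  have "K ?x \<le> (\<Sum>k\<le>n. if k = n then b n ^ 3 else b k ^ 3 * (b n)\<^sup>2) + 8"
    unfolding K_def
    using term_le summable_sums[OF summable_K_term] sums_add[OF c_sums geo]
    by (rule sums_le) simp
  moreover have "8 \<le> b n ^ 3" using power_mono[OF b_ge_2, of 3 n] by simp
  ultimately show ?thesis using c_le by linarith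
qed

section \<open>The holomorphic Koenigs map\<close>

text \<open>Each term of the series has derivative \<open>b n ^ 3 / (c n + z)\<close>, whose real
  part is positive on the half-plane, and this passes to the sum.\<close>

lemma koenigs_map:
  obtains k where "k holomorphic_on \<H>"
    and "\<And>z. z \<in> \<H> \<Longrightarrow> 0 < Re (deriv k z)"
    and "\<And>C. bounded {z \<in> \<H>. Re (k z) \<le> C}"
    and "\<And>x. 0 < x \<Longrightarrow> k (of_real x) = of_real (K x)"
proof -
  define c :: "nat \<Rightarrow> real" where "c n = exp ((b n)\<^sup>2)" for n
  have c_pos [simp]: "0 < c n" for n by (simp add: c_def)
  define f where "f n z = of_real (b n ^ 3) * Ln (1 + z / of_real (c n))" for n and z :: complex
  define f' where "f' n z = of_real (b n ^ 3 / c n) / (1 + z / of_real (c n))" for n and z :: complex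
  have Re_div: "Re (z / of_real (c n)) = Re z / c n" for z n
    by (simp add: Re_divide_of_real)
  have deriv_f: "(f n has_field_derivative f' n z) (at z)" if "z \<in> \<H>" for n z
  proof -
    have "0 < Re (z / of_real (c n))" using that by (simp add: Re_div)
    then have "1 + z / of_real (c n) \<notin> \<real>\<^sub>\<le>\<^sub>0"
      by (auto simp: complex_nonpos_Reals_iff simp del: Re_divide_of_real)
    then show ?thesis
      unfolding f_def f'_def by (auto intro!: derivative_eq_intros simp: divide_inverse mult_ac)
  qed
  have norm_f: "cmod (f n z) \<le> b n ^ 3 * exp (- (b n)\<^sup>2) * cmod z" if "z \<in> \<H>" for n z
  proof -
    have "cmod (Ln (1 + z / of_real (c n))) \<le> cmod (z / of_real (c n))"
      using that by (intro norm_Ln_one_plus_le) (auto simp: Re_div less_imp_le)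
    then have "cmod (f n z) \<le> b n ^ 3 * cmod (z / of_real (c n))"
      unfolding f_def norm_mult
      by (metis (no_types, lifting) abs_of_pos b_pos mult_left_mono norm_ge_zero norm_of_real zero_less_power)
    then show ?thesis
      by (simp add: norm_mult norm_inverse c_def exp_minus divide_inverse mult_ac)
  qed
  have "\<exists>k k'. \<forall>z\<in>\<H>. (\<lambda>n. f n z) sums k z \<and> (\<lambda>n. f' n z) sums k' z
      \<and> (k has_field_derivative k' z) (at z)"
  proof (rule series_and_derivative_comparison_local[OF open_right_half_plane deriv_f])
    fix z :: complex
    \<comment> \<open>A majorant uniform on \<open>ball z 1\<close>, where the modulus is at most
      \<open>cmod z + 1\<close>; it permits termwise differentiation.\<close>
    have "summable (\<lambda>n. b n ^ 3 * exp (- (b n)\<^sup>2) * (cmod z + 1))"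
      by (intro summable_mult2 summable_b_cubed_exp)
    moreover have "cmod (f n y) \<le> b n ^ 3 * exp (- (b n)\<^sup>2) * (cmod z + 1)"
      if "y \<in> ball z 1 \<inter> \<H>" for n y
    proof -
      have "cmod y \<le> cmod z + 1"
        using that norm_triangle_ineq2[of y z] by (auto simp: dist_norm norm_minus_commute)
      then have "b n ^ 3 * exp (- (b n)\<^sup>2) * cmod y \<le> b n ^ 3 * exp (- (b n)\<^sup>2) * (cmod z + 1)"
        by (intro mult_left_mono) (auto simp: less_imp_le)
      with norm_f[of y n] that show ?thesis by (auto simp del: mem_ball intro: order_trans)
    qed
    then have "\<forall>\<^sub>F n in sequentially. \<forall>y\<in>ball z 1 \<inter> \<H>.
        cmod (f n y) \<le> b n ^ 3 * exp (- (b n)\<^sup>2) * (cmod z + 1)"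
      by (intro always_eventually allI ballI)
    ultimately show "\<exists>d h. 0 < d \<and> summable h \<and>
        (\<forall>\<^sub>F n in sequentially. \<forall>y\<in>ball z d \<inter> \<H>. cmod (f n y) \<le> h n)"
      using zero_less_one by blast
  qed auto
  then obtain k k' where k: "\<And>z. z \<in> \<H> \<Longrightarrow> (\<lambda>n. f n z) sums k z"
      "\<And>z. z \<in> \<H> \<Longrightarrow> (\<lambda>n. f' n z) sums k' z"
      "\<And>z. z \<in> \<H> \<Longrightarrow> (k has_field_derivative k' z) (at z)"
    by blast
  show thesis
  proof
    show "k holomorphic_on \<H>"
      using k(3) open_right_half_plane holomorphic_on_open by blast
  next
    fix z assume z: "z \<in> \<H>"
    have "0 < Re (f' n z)" for n
    proof -
      have "0 < Re (1 / (1 + z / of_real (c n)))"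
        unfolding Re_complex_div_gt_0 using z by (simp add: Re_div add_pos_pos)
      then have "0 < (b n ^ 3 / c n) * Re (1 / (1 + z / of_real (c n)))"
        by (intro mult_pos_pos) auto
      moreover have "f' n z = (b n ^ 3 / c n) *\<^sub>R (1 / (1 + z / of_real (c n)))"
        by (simp only: f'_def scaleR_conv_of_real times_divide_eq_right mult_1_right)
      ultimately show ?thesis by (simp only: scaleR_complex.sel)
    qed
    moreover have "(\<lambda>n. Re (f' n z)) sums Re (k' z)" using sums_Re[OF k(2)[OF z]] .
    ultimately have "0 < Re (k' z)"
      using suminf_pos sums_iff by metis
    then show "0 < Re (deriv k z)" using DERIV_imp_deriv[OF k(3)[OF z]] by simp
  next
    fix C
    \<comment> \<open>Every term has nonnegative real part, so the term of index 0 alone is at most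
      \<open>C\<close> in real part; exponentiating it bounds \<open>cmod z\<close>.\<close>
    have "cmod z \<le> c 0 * (exp (C / b 0 ^ 3) + 1)" if z: "z \<in> \<H>" and C: "Re (k z) \<le> C" for z
    proof -
      have ge1: "1 \<le> cmod (1 + z / of_real (c n))" for n
      proof -
        have "0 \<le> Re (z / of_real (c n))" using z by (simp add: Re_div less_imp_le)
        then show ?thesis using complex_Re_le_cmod[of "1 + z / of_real (c n)"] by simp
      qed
      then have "1 + z / of_real (c n) \<noteq> 0" for n
        by (metis norm_zero not_one_le_zero)
      then have Re_f: "Re (f n z) = b n ^ 3 * ln (cmod (1 + z / of_real (c n)))" for n
        unfolding f_def by (simp add: Re_Ln del: of_real_power)
      then have Re_f_nonneg: "0 \<le> Re (f n z)" for n
        using ge1[of n] by (simp add: less_imp_le)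
      have sums: "(\<lambda>n. Re (f n z)) sums Re (k z)" using sums_Re[OF k(1)[OF z]] .
      have "Re (f 0 z) \<le> Re (k z)"
        using sum_le_suminf[OF sums_summable[OF sums], of "{0}"] Re_f_nonneg sums_unique[OF sums]
        by simp
      with C have "ln (cmod (1 + z / of_real (c 0))) \<le> C / b 0 ^ 3"
        by (simp add: Re_f field_simps)
      then have "cmod (1 + z / of_real (c 0)) \<le> exp (C / b 0 ^ 3)"
        using ge1[of 0] by (metis exp_le_cancel_iff exp_ln less_le_trans zero_less_one)
      then have "cmod (z / of_real (c 0)) \<le> exp (C / b 0 ^ 3) + 1"
        using norm_triangle_ineq4[of "1 + z / of_real (c 0)" 1] by simp
      then show ?thesis by (simp add: norm_divide divide_le_eq abs_of_pos mult.commute)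
    qed
    then show "bounded {z \<in> \<H>. Re (k z) \<le> C}" by (auto intro!: boundedI)
  next
    fix x :: real assume x: "0 < x"
    have "f n (of_real x) = of_real (K_term n x)" for n
    proof -
      have "1 + complex_of_real x / of_real (c n) = of_real (1 + x / c n)" by simp
      moreover have "0 < 1 + x / c n" using x by (intro add_pos_pos) auto
      ultimately show ?thesis
        by (simp add: f_def K_term_def Ln_of_real c_def del: of_real_add)
    qed
    moreover have "(\<lambda>n. complex_of_real (K_term n x)) sums of_real (K x)"
      unfolding K_def sums_of_real_iff using x by (intro summable_sums summable_K_term) simp
    ultimately show "k (of_real x) = of_real (K x)"
      using k(1)[of "of_real x"] x sums_unique2 by auto
  qed
qed

section \<open>Limits along sequences of times, and the conclusion\<close>

lemma Limsup_at_top_eq_infinity: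
  fixes u :: "real \<Rightarrow> real"
  assumes t: "filterlim t at_top sequentially" and u: "filterlim (\<lambda>n. u (t n)) at_top sequentially"
  shows "Limsup at_top (\<lambda>x. ereal (u x)) = \<infinity>"
proof (rule ccontr)
  assume "Limsup at_top (\<lambda>x. ereal (u x)) \<noteq> \<infinity>"
  then obtain C :: real where "Limsup at_top (\<lambda>x. ereal (u x)) < ereal C"
    by (metis ereal_infty_less(1) less_PInf_Ex_of_nat)
  then have "\<forall>\<^sub>F x in at_top. u x < C"
    using Limsup_lessD by fastforce
  then have "\<forall>\<^sub>F n in sequentially. u (t n) < C"
    using t eventually_compose_filterlim by blast
  moreover have "\<forall>\<^sub>F n in sequentially. C \<le> u (t n)"
    using u by (simp add: filterlim_at_top)
  ultimately have "\<forall>\<^sub>F n in sequentially. False" by eventually_elim simp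
  then show False by simp
qed

lemma Liminf_at_top_eq_0:
  fixes u :: "real \<Rightarrow> real"
  assumes nonneg: "\<forall>\<^sub>F x in at_top. 0 \<le> u x"
    and t: "filterlim t at_top sequentially" and u: "(\<lambda>n. u (t n)) \<longlonglongrightarrow> 0"
  shows "Liminf at_top (\<lambda>x. ereal (u x)) = 0"
proof (rule antisym)
  show "0 \<le> Liminf at_top (\<lambda>x. ereal (u x))"
    using nonneg by (intro Liminf_bounded) simp
  show "Liminf at_top (\<lambda>x. ereal (u x)) \<le> 0"
  proof (rule ccontr)
    assume "\<not> Liminf at_top (\<lambda>x. ereal (u x)) \<le> 0"
    then obtain C :: real where C: "0 < C" "ereal C < Liminf at_top (\<lambda>x. ereal (u x))"
      by (metis ereal_dense2 ereal_less(2) not_le)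
    then have "\<forall>\<^sub>F x in at_top. C < u x"
      using less_LiminfD by fastforce
    then have "\<forall>\<^sub>F n in sequentially. C < u (t n)"
      using t eventually_compose_filterlim by blast
    moreover have "\<forall>\<^sub>F n in sequentially. u (t n) < C"
      using u C(1) by (rule order_tendstoD)
    ultimately have "\<forall>\<^sub>F n in sequentially. False" by eventually_elim simp
    then show False by simp
  qed
qed

theorem theorem1p3:
  shows "\<exists>(\<alpha>::real) \<phi>. 0 < \<alpha> \<and> \<alpha> < 1 \<and> holo_semigroup \<phi> \<and> non_elliptic \<phi> \<and>
           Limsup at_top (\<lambda>t::real. ereal (total_speed \<phi> t / t powr \<alpha>)) = \<infinity> \<and>
           Liminf at_top (\<lambda>t::real. ereal (total_speed \<phi> t / t powr \<alpha>)) = 0"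
proof -
  obtain k where k: "k holomorphic_on \<H>"
      "\<And>z. z \<in> \<H> \<Longrightarrow> 0 < Re (deriv k z)"
      "\<And>C. bounded {z \<in> \<H>. Re (k z) \<le> C}"
      "\<And>x. 0 < x \<Longrightarrow> k (of_real x) = of_real (K x)"
    using koenigs_map by blast
  obtain \<phi> where \<phi>: "holo_semigroup \<phi>" "non_elliptic \<phi>"
      "\<And>t x. 0 \<le> t \<Longrightarrow> 1 \<le> x \<Longrightarrow> k (of_real x) = k 1 + of_real t \<Longrightarrow> total_speed \<phi> t = ln x / 2"
    using semigroup_of_koenigs_map[OF k(1-3)] by blast
  \<comment> \<open>Time is parametrised by the position \<open>x\<close> that the orbit has reached
    in the half-plane, so \<open>K\<close> never has to be inverted.\<close>
  have speed: "total_speed \<phi> (K x - K 1) = ln x / 2" if "1 \<le> x" for x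
    using that K_mono[of 1 x] k(4)[of x] k(4)[of 1] by (intro \<phi>(3)) auto
  let ?u = "\<lambda>t. total_speed \<phi> t / t powr (1 / 2)"
  have time_lim: "filterlim (\<lambda>n. K (exp (r * (b n)\<^sup>2)) - K 1) at_top sequentially"
    if "0 < r" for r
  proof -
    have "filterlim (\<lambda>x. exp (r * x\<^sup>2)) at_top at_top" using that by real_asymp
    then have "filterlim (\<lambda>n. K (exp (r * (b n)\<^sup>2))) at_top sequentially"
      by (intro filterlim_compose[OF filterlim_K] filterlim_compose[OF _ filterlim_b])
    from filterlim_tendsto_add_at_top[OF tendsto_const[of "- K 1"] this] show ?thesis by simp
  qed
  \<comment> \<open>The orbit is at \<open>exp (b n ^ 2)\<close> at time \<open>s n\<close>, early
    relative to its speed, and at \<open>exp (2 * b n ^ 2)\<close> at time \<open>t n\<close>, late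
    relative to it. The first sequence yields the limsup, the second the liminf.\<close>
  define s where "s n = K (exp ((b n)\<^sup>2)) - K 1" for n
  define t where "t n = K (exp (2 * (b n)\<^sup>2)) - K 1" for n
  have s_lim: "filterlim s at_top sequentially" and t_lim: "filterlim t at_top sequentially"
    unfolding s_def t_def using time_lim[of 1] time_lim[of 2] by auto
  have "filterlim (\<lambda>n. ?u (s n)) at_top sequentially"
  proof (rule filterlim_at_top_mono)
    \<comment> \<open>The speed at \<open>s n\<close> is \<open>b n ^ 2 / 2\<close>, while
      \<open>sqrt (s n)\<close> is at most \<open>2 * b n * sqrt (b n)\<close>.\<close>
    show "filterlim (\<lambda>n. sqrt (b n) / 4) at_top sequentially"
      by (rule filterlim_compose[OF _ filterlim_b]) real_asymp
    have "\<forall>\<^sub>F n in sequentially. 0 < s n"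
      using s_lim by (simp add: filterlim_at_top_dense)
    then show "\<forall>\<^sub>F n in sequentially. sqrt (b n) / 4 \<le> ?u (s n)"
    proof eventually_elim
      case (elim n)
      have "s n \<le> 4 * b n ^ 3" using K_exp_le[of n] K_nonneg[of 1] by (simp add: s_def)
      then have "sqrt (s n) \<le> sqrt (4 * b n ^ 3)" by simp
      also have "\<dots> = 2 * b n * sqrt (b n)"
        by (simp add: real_sqrt_mult power3_eq_cube abs_of_pos)
      finally have "(b n)\<^sup>2 / 2 / (2 * b n * sqrt (b n)) \<le> (b n)\<^sup>2 / 2 / sqrt (s n)"
        using elim by (intro divide_left_mono) auto
      moreover have "(b n)\<^sup>2 / 2 / (2 * b n * sqrt (b n)) = sqrt (b n) / 4"
        using less_imp_le[OF b_pos[of n]] by (simp add: power2_eq_square real_div_sqrt)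
      moreover have "total_speed \<phi> (s n) = (b n)\<^sup>2 / 2"
        using speed[of "exp ((b n)\<^sup>2)"] by (simp add: s_def)
      ultimately have "sqrt (b n) / 4 \<le> total_speed \<phi> (s n) / sqrt (s n)" by (simp only:)
      then show ?case using elim by (simp add: powr_half_sqrt)
    qed
  qed
  then have limsup: "Limsup at_top (\<lambda>t. ereal (?u t)) = \<infinity>"
    by (rule Limsup_at_top_eq_infinity[OF s_lim])
  have "(\<lambda>n. ?u (t n)) \<longlonglongrightarrow> 0"
  proof (rule tendsto_sandwich[OF _ _ tendsto_const])
    \<comment> \<open>The speed at \<open>t n\<close> is \<open>b n ^ 2\<close>, while
      \<open>t n\<close> is eventually at least \<open>b n ^ 5 / 2\<close>; the factor 1/2 absorbs
      the offset \<open>K 1\<close>.\<close>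
    show "(\<lambda>n. sqrt (2 / b n)) \<longlonglongrightarrow> 0"
      by (rule filterlim_compose[OF _ filterlim_b]) real_asymp
    have "filterlim (\<lambda>x::real. x ^ 5) at_top at_top" by real_asymp
    then have "filterlim (\<lambda>n. b n ^ 5) at_top sequentially"
      by (rule filterlim_compose[OF _ filterlim_b])
    then have ev: "\<forall>\<^sub>F n in sequentially. 2 * K 1 \<le> b n ^ 5" by (simp add: filterlim_at_top)
    have bounds: "0 \<le> ?u (t n) \<and> ?u (t n) \<le> sqrt (2 / b n)" if "2 * K 1 \<le> b n ^ 5" for n
    proof -
      have "b n ^ 5 \<le> K (exp (2 * (b n)\<^sup>2))"
        using K_ge[of "exp (2 * (b n)\<^sup>2)" n] by (simp flip: power_add)
      then have "b n ^ 5 / 2 \<le> t n" using that by (simp add: t_def)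
      then have *: "sqrt (b n ^ 5 / 2) \<le> sqrt (t n)" "0 < t n"
        using zero_less_power[OF b_pos[of n], of 5] by (simp, linarith)
      then have "(b n)\<^sup>2 / sqrt (t n) \<le> (b n)\<^sup>2 / sqrt (b n ^ 5 / 2)"
        by (intro divide_left_mono) auto
      also have "\<dots> = sqrt (b n ^ 4) / sqrt (b n ^ 5 / 2)"
        using real_sqrt_unique[of "(b n)\<^sup>2" "b n ^ 4"] by (simp flip: power_mult)
      also have "\<dots> = sqrt ((b n ^ 4) / (b n ^ 5 / 2))"
        by (simp only: real_sqrt_divide)
      also have "(b n ^ 4) / (b n ^ 5 / 2) = 2 / b n"
        by (simp add: field_simps power_numeral_reduce)
      finally show ?thesis
        using speed[of "exp (2 * (b n)\<^sup>2)"] *(2) by (simp add: t_def powr_half_sqrt)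
    qed
    show "\<forall>\<^sub>F n in sequentially. 0 \<le> ?u (t n)"
      and "\<forall>\<^sub>F n in sequentially. ?u (t n) \<le> sqrt (2 / b n)"
      using ev by (auto elim!: eventually_mono dest: bounds)
  qed
  \<comment> \<open>The lower bound for the liminf concerns all large times, not only the
    \<open>t n\<close>; it holds because the orbit of 0 stays in the disc.\<close>
  moreover have "0 \<le> ?u x" if "0 \<le> x" for x
  proof -
    have "0 \<in> \<D>" by simp
    then have "cmod (\<phi> x 0) < 1"
      using \<phi>(1) that unfolding holo_semigroup_def by (metis image_subset_iff mem_ball_0)
    then have "1 \<le> (1 + cmod (\<phi> x 0)) / (1 - cmod (\<phi> x 0))" by (simp add: field_simps)
    then show ?thesis by (simp add: total_speed_def hyp_dist_def)
  qed
  ultimately have liminf: "Liminf at_top (\<lambda>t. ereal (?u t)) = 0"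
    by (intro Liminf_at_top_eq_0[OF _ t_lim]) (auto intro: eventually_at_top_linorderI[of 0])
  show ?thesis
    using \<phi>(1,2) limsup liminf by (intro exI[of _ "1/2"] exI[of _ \<phi>]) simp
qed

end
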